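(* Let $k$ be a nonnegative integer. Then $${\rm ord}_2(t^e_{4k})=2\left\lfloor\frac{k+1}{2}\right\rfloor=k+\chi_o(k).$$
   Context: $t^e_n$ is the number of involutions of $[n]$ (permutations with $\pi^2=1$) having an even number of 2-cycles, with $t^e_0=1$. $\chi_o(k)=1$ if $k$ is odd and $0$ otherwise. ${\rm ord}_2(m)$ is the largest integer $e$ with $2^e\mid m$. *)

theory Defs
  imports
    "HOL-Combinatorics.Permutations"
    "HOL-Combinatorics.Orbits"
    "HOL-Computational_Algebra.Primes"
begin

definition involutions :: "nat \<Rightarrow> (nat \<Rightarrow> nat) set" where
  "involutions n = {p. p permutes {1..n} \<and> p \<circ> p = id}"

text \<open>A cycle is identified with its underlying set.  For a permutation of
  order at most 2 this loses nothing: a 2-cycle \<open>(a b)\<close> is determined by \<open>{a, b}\<close>.\<close>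

definition two_cycles :: "(nat \<Rightarrow> nat) \<Rightarrow> nat set set" where
  "two_cycles p = {C. cyclic_on p C \<and> card C = 2}"

definition t_e :: "nat \<Rightarrow> nat" where
  "t_e n = card {p \<in> involutions n. even (card (two_cycles p))}"

definition chi_o :: "nat \<Rightarrow> nat" where
  "chi_o k = (if odd k then 1 else 0)"

text \<open>The convention for \<open>n = 0\<close> holds because the empty permutation is counted;
  positivity ensures that the library's default value \<open>multiplicity 2 0 = 0\<close>
  is never reached when taking 2-adic orders.\<close>

lemma two_cycles_id: "two_cycles id = {}"
proof -
  have "orbit id x = {x}" for x :: nat
    by (auto simp: orbit_altdef)
  then show ?thesis
    by (auto simp: two_cycles_def cyclic_on_def)
qed

lemma t_e_0: "t_e 0 = 1"
proof -
  have "{p \<in> involutions 0. even (card (two_cycles p))} = {id}"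
    by (auto simp: involutions_def two_cycles_id)
  then show ?thesis by (simp add: t_e_def)
qed

lemma t_e_pos: "t_e n > 0"
proof -
  have "finite (involutions n)"
    by (rule finite_subset[OF _ finite_permutations[of "{1..n}"]])
       (auto simp: involutions_def)
  moreover have "id \<in> {p \<in> involutions n. even (card (two_cycles p))}"
    by (simp add: involutions_def two_cycles_id permutes_id)
  ultimately show ?thesis
    unfolding t_e_def by (metis (no_types, lifting) card_gt_0_iff empty_iff
      finite_Collect_conjI finite_subset mem_Collect_eq subsetI)
qed

end

theory Submission
  imports Defs
begin

text \<open>Weight every involution by \<open>w\<close> to the number of its 2-cycles. The weighted count
  \<open>u n\<close> of the involutions of \<open>[n]\<close> satisfies
  \<open>u (n + 2) = u (n + 1) + w (n + 1) u n\<close>, and \<open>t_e\<close> is half the sum of the counts for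
  \<open>w = 1\<close> and \<open>w = - 1\<close>. For \<open>w = \<plusminus> 1\<close>, going from the pair \<open>u (4 k), u (4 k + 1)\<close> to the
  next such pair produces a factor 2, and once it is divided out the pair evolves linearly
  with coefficients that modulo 8 depend only on \<open>k mod 4\<close>. Its residues modulo 8 turn out to
  have period 4 in \<open>k\<close>. The sum of the two leading residues is 2 modulo 4 for even \<open>k\<close>, and
  4 modulo 8 for odd \<open>k\<close>, which gives the 2-adic order.\<close>

section \<open>Involutions of a set and their 2-cycles\<close>

text \<open>Arbitrary ground sets are needed because deleting a 2-cycle from an involution of
  \<open>{1..n}\<close> leaves a set that need not be an initial segment.\<close>

definition involutions_on :: "'a set \<Rightarrow> ('a \<Rightarrow> 'a) set" where
  "involutions_on S = {p. p permutes S \<and> p \<circ> p = id}"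

lemma finite_involutions_on: "finite S \<Longrightarrow> finite (involutions_on S)"
  unfolding involutions_on_def by (rule finite_subset[OF _ finite_permutations[of S]]) auto

lemma orbit_involution:
  assumes "p \<circ> p = id"
  shows "orbit p x = {x, p x}"
proof -
  have pp: "p (p y) = y" for y using assms by (metis comp_apply id_apply)
  have "y \<in> {x, p x}" if "y \<in> orbit p x" for y
    using that by induction (auto simp: pp)
  moreover have "p x \<in> orbit p x" by (rule orbit.base)
  moreover have "x \<in> orbit p x" using orbit.step[OF orbit.base[of p x]] by (simp add: pp)
  ultimately show ?thesis by blast
qed

text \<open>Orbits have the form \<open>{x, p x}\<close>, so those of size 2 come from the moved
  points; each is hit twice, by \<open>x\<close> and by \<open>p x\<close>.\<close>

lemma two_cycles_involution:
  assumes "p \<circ> p = id"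
  shows "two_cycles p = (\<lambda>x. {x, p x}) ` {x. p x \<noteq> x}"
proof -
  have pp: "p (p y) = y" for y using assms by (metis comp_apply id_apply)
  have "card {x, p x} = 2 \<longleftrightarrow> p x \<noteq> x" for x by auto
  then show ?thesis
    by (fastforce simp: two_cycles_def cyclic_on_def orbit_involution[OF assms])
qed

lemma finite_two_cycles:
  assumes "finite S" "p \<in> involutions_on S"
  shows "finite (two_cycles p)"
proof -
  have "{x. p x \<noteq> x} \<subseteq> S"
    using assms(2) by (auto simp: involutions_on_def permutes_def)
  then show ?thesis
    using assms finite_subset by (auto simp: involutions_on_def two_cycles_involution)
qed

section \<open>Adjoining and removing a 2-cycle\<close>

text \<open>Since \<open>q\<close> permutes \<open>S - {i}\<close> and \<open>x\<close> lies outside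
  \<open>S\<close>, it fixes both \<open>i\<close> and \<open>x\<close>. The transposition is
  therefore disjoint from \<open>q\<close> and contributes exactly one new 2-cycle.\<close>

lemma comp_transpose_involution:
  fixes S :: "nat set"
  assumes q: "q \<in> involutions_on (S - {i})" and "x \<notin> S" "i \<in> S"
  shows "q \<circ> transpose i x \<in> involutions_on (insert x S)"
    and "(q \<circ> transpose i x) x = i"
    and "two_cycles (q \<circ> transpose i x) = insert {i, x} (two_cycles q)"
    and "{i, x} \<notin> two_cycles q"
proof -
  have per: "q permutes (S - {i})" and qq: "q \<circ> q = id"
    using q by (auto simp: involutions_on_def)
  have pp: "q (q y) = y" for y using qq by (metis comp_apply id_apply)
  have qi: "q i = i" and qx: "q x = x"
    using permutes_not_in[OF per, of i] permutes_not_in[OF per, of x] assms(2) by auto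
  let ?p = "q \<circ> transpose i x"
  have ne: "x \<noteq> i" using assms by auto
  \<comment> \<open>By injectivity only \<open>i\<close> and \<open>x\<close> themselves map to
    \<open>i\<close> and \<open>x\<close>, so a second application of \<open>?p\<close> stays in the
    same branch of \<open>p_eq\<close>.\<close>
  have qne: "y \<noteq> i \<Longrightarrow> q y \<noteq> i" "y \<noteq> x \<Longrightarrow> q y \<noteq> x" for y
    using pp qi qx by metis+
  have p_eq: "?p y = (if y = x then i else if y = i then x else q y)" for y
    by (auto simp: transpose_def qi qx)
  have "transpose i x permutes insert x S"
    using assms by (intro permutes_swap_id) auto
  moreover have "q permutes insert x S"
    using per by (rule permutes_subset) auto
  ultimately have "?p permutes insert x S" by (rule permutes_compose)
  moreover have "?p (?p y) = y" for y
    unfolding p_eq using qne pp by auto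
  then have ppid: "?p \<circ> ?p = id" by (intro ext) simp
  ultimately show "?p \<in> involutions_on (insert x S)" by (simp add: involutions_on_def)
  show "?p x = i" by (simp add: qi)
  have "{y. ?p y \<noteq> y} = insert i (insert x {y. q y \<noteq> y})"
    unfolding p_eq using qi qx ne by auto
  \<comment> \<open>Points moved by \<open>q\<close> differ from \<open>i\<close> and
    \<open>x\<close>, and there \<open>?p\<close> agrees with \<open>q\<close>.\<close>
  moreover have "(\<lambda>y. {y, ?p y}) ` {y. q y \<noteq> y} = (\<lambda>y. {y, q y}) ` {y. q y \<noteq> y}"
    by (rule image_cong) (auto simp: p_eq qi qx simp del: o_apply)
  moreover have "{i, ?p i} = {i, x}" "{x, ?p x} = {i, x}"
    unfolding p_eq using ne by auto
  ultimately show "two_cycles ?p = insert {i, x} (two_cycles q)"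
    unfolding two_cycles_involution[OF ppid] two_cycles_involution[OF qq] by (simp del: o_apply)
  show "{i, x} \<notin> two_cycles q"
    unfolding two_cycles_involution[OF qq] using qi qx by (auto simp: doubleton_eq_iff)
qed

lemma involutions_on_fixing:
  assumes "x \<notin> S"
  shows "{p \<in> involutions_on (insert x S). p x = x} = involutions_on S"
proof (intro equalityI subsetI)
  fix p assume "p \<in> {p \<in> involutions_on (insert x S). p x = x}"
  then show "p \<in> involutions_on S"
    using permutes_superset[of p "insert x S" S] by (auto simp: involutions_on_def)
next
  fix p assume "p \<in> involutions_on S"
  then show "p \<in> {p \<in> involutions_on (insert x S). p x = x}"
    using permutes_subset[of p S "insert x S"] permutes_not_in[of p S x] assms
    by (auto simp: involutions_on_def)
qed

text \<open>A transposition is its own inverse, so the same composition undoes the map. If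
  \<open>p x = i\<close> then \<open>p i = x\<close>, and composing turns both into fixed
  points.\<close>

lemma bij_betw_involutions_moving:
  fixes S :: "nat set"
  assumes "x \<notin> S" "i \<in> S"
  shows "bij_betw (\<lambda>q. q \<circ> transpose i x) (involutions_on (S - {i}))
    {p \<in> involutions_on (insert x S). p x = i}"
proof (rule bij_betw_byWitness[where f' = "\<lambda>p. p \<circ> transpose i x"])
  show "(\<lambda>q. q \<circ> transpose i x) ` involutions_on (S - {i})
      \<subseteq> {p \<in> involutions_on (insert x S). p x = i}"
    using comp_transpose_involution[OF _ assms] by blast
  show "(\<lambda>p. p \<circ> transpose i x) ` {p \<in> involutions_on (insert x S). p x = i}
      \<subseteq> involutions_on (S - {i})"
  proof clarify
    fix p assume p: "p \<in> involutions_on (insert x S)" and i: "i = p x"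
    have per: "p permutes insert x S" and ppid: "p \<circ> p = id"
      using p by (auto simp: involutions_on_def)
    have pp: "p (p y) = y" for y using ppid by (metis comp_apply id_apply)
    let ?q = "p \<circ> transpose (p x) x"
    have ne: "p x \<noteq> x" using assms i by auto
    have q_eq: "?q y = (if y = x then x else if y = p x then p x else p y)" for y
      by (auto simp: transpose_def pp)
    have "y \<noteq> p x \<Longrightarrow> p y \<noteq> x" "y \<noteq> x \<Longrightarrow> p y \<noteq> p x" for y using pp by metis+
    then have "?q (?q y) = y" for y
      unfolding q_eq using pp by auto
    then have "?q \<circ> ?q = id" by (intro ext) simp
    moreover have "?q permutes insert x S"
      using per i assms by (intro permutes_compose[of _ _ p] permutes_swap_id) auto
    then have "?q permutes (S - {p x})"
      by (rule permutes_superset) (auto simp: q_eq simp del: o_apply)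
    ultimately show "?q \<in> involutions_on (S - {p x})" by (simp add: involutions_on_def)
  qed
qed (auto simp: fun_eq_iff)

section \<open>The weighted count and its recurrence\<close>

text \<open>For \<open>w = 1\<close> these are the telephone numbers; for \<open>w = - 1\<close>,
  the excess of involutions with an even number of 2-cycles over those with an odd number. The
  factor \<open>int n + 1\<close> counts the possible partners of the last of \<open>n + 2\<close>
  points.\<close>

fun weighted_involutions :: "int \<Rightarrow> nat \<Rightarrow> int" where
  "weighted_involutions w 0 = 1"
| "weighted_involutions w (Suc 0) = 1"
| "weighted_involutions w (Suc (Suc n)) =
    weighted_involutions w (Suc n) + w * (int n + 1) * weighted_involutions w n"

text \<open>Involutions are sorted by the image of \<open>x\<close>: either \<open>x\<close> is
  fixed, or it is paired with some \<open>i\<close>, and that 2-cycle accounts for one factor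
  \<open>w\<close>.\<close>

lemma sum_involutions_insert:
  fixes S :: "nat set" and w :: int
  assumes fin: "finite S" and x: "x \<notin> S"
  shows "(\<Sum>p\<in>involutions_on (insert x S). w ^ card (two_cycles p)) =
    (\<Sum>p\<in>involutions_on S. w ^ card (two_cycles p)) +
    (\<Sum>i\<in>S. w * (\<Sum>p\<in>involutions_on (S - {i}). w ^ card (two_cycles p)))"
proof -
  let ?I = "involutions_on (insert x S)"
  let ?g = "\<lambda>p. w ^ card (two_cycles p)"
  have "p x \<in> insert x S" if "p \<in> ?I" for p
    using that permutes_in_image[of p "insert x S" x] by (auto simp: involutions_on_def)
  then have "sum ?g ?I = (\<Sum>i\<in>insert x S. sum ?g {p \<in> ?I. p x = i})"
    using fin by (intro sum.group[symmetric] finite_involutions_on) auto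
  also have "\<dots> = sum ?g {p \<in> ?I. p x = x} + (\<Sum>i\<in>S. sum ?g {p \<in> ?I. p x = i})"
    using fin x by simp
  also have "(\<Sum>i\<in>S. sum ?g {p \<in> ?I. p x = i}) =
      (\<Sum>i\<in>S. w * sum ?g (involutions_on (S - {i})))"
  proof (rule sum.cong[OF refl])
    fix i assume i: "i \<in> S"
    have "sum ?g {p \<in> ?I. p x = i} =
        (\<Sum>q\<in>involutions_on (S - {i}). ?g (q \<circ> transpose i x))"
      by (rule sum.reindex_bij_betw[OF bij_betw_involutions_moving[OF x i], symmetric])
    also have "\<dots> = (\<Sum>q\<in>involutions_on (S - {i}). w * ?g q)"
    proof (rule sum.cong[OF refl])
      fix q assume q: "q \<in> involutions_on (S - {i})"
      have "finite (two_cycles q)" using finite_two_cycles[OF _ q] fin by simp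
      then show "?g (q \<circ> transpose i x) = w * ?g q"
        using comp_transpose_involution(3,4)[OF q x i] by simp
    qed
    finally show "sum ?g {p \<in> ?I. p x = i} = w * sum ?g (involutions_on (S - {i}))"
      by (simp add: sum_distrib_left)
  qed
  finally show ?thesis by (simp add: involutions_on_fixing[OF x])
qed

text \<open>Strong induction on the cardinality, because removing a pair drops it by two. By the
  induction hypothesis the inner sums are the same for every partner \<open>i\<close>.\<close>

lemma sum_involutions_on:
  fixes S :: "nat set" and w :: int
  assumes "finite S"
  shows "(\<Sum>p\<in>involutions_on S. w ^ card (two_cycles p)) = weighted_involutions w (card S)"
  using assms
proof (induction "card S" arbitrary: S rule: less_induct)
  case less
  show ?case
  proof (cases "S = {}")
    case True
    have "involutions_on {} = {id :: nat \<Rightarrow> nat}" by (auto simp: involutions_on_def)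
    then show ?thesis using True by (simp add: two_cycles_id)
  next
    case False
    then obtain x T where S: "S = insert x T" "x \<notin> T" by (meson Set.set_insert ex_in_conv)
    have T: "finite T" and cS: "card S = Suc (card T)" using S less.prems by auto
    have "(\<Sum>p\<in>involutions_on (T - {i}). w ^ card (two_cycles p)) =
        weighted_involutions w (card T - 1)" if "i \<in> T" for i
      using less.hyps[of "T - {i}"] T cS that by simp
    moreover have "(\<Sum>p\<in>involutions_on T. w ^ card (two_cycles p)) =
        weighted_involutions w (card T)"
      using less.hyps[of T] T cS by simp
    ultimately have "(\<Sum>p\<in>involutions_on S. w ^ card (two_cycles p)) =
        weighted_involutions w (card T)
        + int (card T) * (w * weighted_involutions w (card T - 1))"
      using sum_involutions_insert[OF T S(2), of w] S(1) by simp
    \<comment> \<open>For \<open>card T = 0\<close> the truncated \<open>card T - 1\<close> is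
      harmless, as its term carries the factor \<open>int (card T)\<close>.\<close>
    then show ?thesis unfolding cS by (cases "card T") (simp_all add: algebra_simps)
  qed
qed

text \<open>\<open>1 + (- 1) ^ c\<close> is 2 for even \<open>c\<close> and 0 for odd
  \<open>c\<close>.\<close>

lemma t_e_weighted:
  "2 * int (t_e n) = weighted_involutions 1 n + weighted_involutions (- 1) n"
proof -
  let ?I = "involutions_on {1..n}"
  have fin: "finite ?I" by (simp add: finite_involutions_on)
  have "weighted_involutions 1 n + weighted_involutions (- 1) n =
      (\<Sum>p\<in>?I. 1 ^ card (two_cycles p) + (- 1) ^ card (two_cycles p))"
    using sum_involutions_on[of "{1..n}" 1] sum_involutions_on[of "{1..n}" "- 1"]
    by (simp add: sum.distrib)
  also have "\<dots> = (\<Sum>p\<in>?I. if even (card (two_cycles p)) then 2 else 0)"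
    by (rule sum.cong) auto
  also have "\<dots> = (\<Sum>p\<in>{p \<in> ?I. even (card (two_cycles p))}. 2)"
    by (rule sum.inter_filter[OF fin, symmetric])
  also have "\<dots> = 2 * int (t_e n)"
    by (simp add: t_e_def involutions_def involutions_on_def)
  finally show ?thesis by simp
qed

section \<open>Four steps of the recurrence, and residues modulo 8\<close>

text \<open>If \<open>w * w = 1\<close>, the coefficients of \<open>c\<close> and \<open>a\<close>
  at index \<open>4 * k + 4\<close> are \<open>1 + w * (8 * m + 5)\<close> and
  \<open>(4 * m + 1) * (w + 4 * m + 3)\<close>, up to the factor \<open>r\<close>. Both are even for
  \<open>w = 1\<close> and \<open>w = - 1\<close>, and the next value differs by a multiple of
  \<open>4 * (m + 1)\<close>. The factor \<open>r\<close> will be \<open>2 ^ k\<close>.\<close>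

lemma weighted_involutions_step4:
  fixes k :: nat
  defines "m \<equiv> int k"
  assumes "weighted_involutions w (4 * k) = r * a" "weighted_involutions w (4 * k + 1) = r * c"
  shows "w = 1 \<Longrightarrow> weighted_involutions w (4 * Suc k) =
      2 * r * ((4 * m + 3) * c + 2 * (m + 1) * (4 * m + 1) * a)"
    and "w = 1 \<Longrightarrow> weighted_involutions w (4 * Suc k + 1) =
      2 * r * ((4 * m + 3) * c + 2 * (m + 1) * (4 * m + 1) * a
        + 2 * (m + 1) * ((4 * m + 3) * c + (4 * m + 1) * a))"
    and "w = - 1 \<Longrightarrow> weighted_involutions w (4 * Suc k) =
      2 * r * ((4 * m + 1) * (2 * m + 1) * a - (4 * m + 2) * c)"
    and "w = - 1 \<Longrightarrow> weighted_involutions w (4 * Suc k + 1) =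
      2 * r * ((4 * m + 1) * (2 * m + 1) * a - (4 * m + 2) * c
        + 2 * (m + 1) * (4 * m + 1) * (c + a))"
proof -
  let ?u = "weighted_involutions w"
  have idx: "4 * Suc k = Suc (Suc (Suc (Suc (4 * k))))" by simp
  have u0: "?u (4 * k) = r * a" and u1: "?u (Suc (4 * k)) = r * c" using assms by simp_all
  have u2: "?u (Suc (Suc (4 * k))) = r * (c + w * (4 * m + 1) * a)"
    by (simp only: weighted_involutions.simps u0 u1) (simp add: m_def algebra_simps)
  have u3: "?u (Suc (Suc (Suc (4 * k)))) = r * (c + w * (4 * m + 1) * a + w * (4 * m + 2) * c)"
    by (simp only: weighted_involutions.simps(3)[of w "Suc (4 * k)"] u1 u2)
      (simp add: m_def algebra_simps)
  have u4: "?u (4 * Suc k) = r * (c + w * (4 * m + 1) * a + w * (4 * m + 2) * c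
      + w * (4 * m + 3) * (c + w * (4 * m + 1) * a))"
    by (simp only: idx weighted_involutions.simps(3)[of w "Suc (Suc (4 * k))"] u2 u3)
      (simp add: m_def algebra_simps)
  have u5: "?u (4 * Suc k + 1) = ?u (4 * Suc k)
      + w * (4 * m + 4) * (r * (c + w * (4 * m + 1) * a + w * (4 * m + 2) * c))"
    by (simp only: Suc_eq_plus1[symmetric] idx
        weighted_involutions.simps(3)[of w "Suc (Suc (Suc (4 * k)))"] u3)
      (simp add: m_def algebra_simps del: weighted_involutions.simps)
  show "w = 1 \<Longrightarrow> weighted_involutions w (4 * Suc k) =
      2 * r * ((4 * m + 3) * c + 2 * (m + 1) * (4 * m + 1) * a)"
    and "w = 1 \<Longrightarrow> weighted_involutions w (4 * Suc k + 1) =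
      2 * r * ((4 * m + 3) * c + 2 * (m + 1) * (4 * m + 1) * a
        + 2 * (m + 1) * ((4 * m + 3) * c + (4 * m + 1) * a))"
    and "w = - 1 \<Longrightarrow> weighted_involutions w (4 * Suc k) =
      2 * r * ((4 * m + 1) * (2 * m + 1) * a - (4 * m + 2) * c)"
    and "w = - 1 \<Longrightarrow> weighted_involutions w (4 * Suc k + 1) =
      2 * r * ((4 * m + 1) * (2 * m + 1) * a - (4 * m + 2) * c
        + 2 * (m + 1) * (4 * m + 1) * (c + a))"
    unfolding u5 u4 by (simp_all add: algebra_simps)
qed

text \<open>Adding 4 to \<open>m\<close> changes each coefficient by 8 or 16.\<close>

lemma coefficients_mod_8:
  fixes m :: int
  shows "(4 * m + 1) mod 8 = (4 * (m mod 4) + 1) mod 8"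
    and "(4 * m + 2) mod 8 = (4 * (m mod 4) + 2) mod 8"
    and "(4 * m + 3) mod 8 = (4 * (m mod 4) + 3) mod 8"
    and "(2 * m + 1) mod 8 = (2 * (m mod 4) + 1) mod 8"
    and "(2 * (m + 1)) mod 8 = (2 * (m mod 4 + 1)) mod 8"
proof -
  define j r where "j = m div 4" and "r = m mod 4"
  have m: "m = 4 * j + r" by (simp add: j_def r_def)
  have "4 * m + d = 4 * r + d + 8 * (2 * j)" "2 * m + d = 2 * r + d + 8 * j"
    "2 * (m + 1) = 2 * (r + 1) + 8 * j" for d
    by (simp_all add: m)
  then show "(4 * m + 1) mod 8 = (4 * (m mod 4) + 1) mod 8"
    and "(4 * m + 2) mod 8 = (4 * (m mod 4) + 2) mod 8"
    and "(4 * m + 3) mod 8 = (4 * (m mod 4) + 3) mod 8"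
    and "(2 * m + 1) mod 8 = (2 * (m mod 4) + 1) mod 8"
    and "(2 * (m + 1)) mod 8 = (2 * (m mod 4 + 1)) mod 8"
    unfolding r_def[symmetric] by (simp_all only: mod_mult_self2)
qed

text \<open>The table is the orbit of the starting pair \<open>(1, 1)\<close> under the four-step
  map; it returns after four rounds, so the induction closes. Both residues are tracked because the
  recurrence has order two.\<close>

lemma weighted_involutions_plus_residues:
  "\<exists>a c. weighted_involutions 1 (4 * k) = 2 ^ k * a \<and>
    weighted_involutions 1 (4 * k + 1) = 2 ^ k * c \<and>
    (k mod 4, a mod 8, c mod 8) \<in> {(0, 1, 1), (1, 5, 5), (2, 7, 7), (3, 7, 7)}"
proof (induction k)
  case 0
  show ?case by (intro exI[of _ 1]) simp
next
  case (Suc k)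
  then obtain a c where ac: "weighted_involutions 1 (4 * k) = 2 ^ k * a"
    "weighted_involutions 1 (4 * k + 1) = 2 ^ k * c"
    and res: "(k mod 4, a mod 8, c mod 8) \<in> {(0, 1, 1), (1, 5, 5), (2, 7, 7), (3, 7, 7)}"
    by (elim exE conjE) (rule that; assumption)
  define m where "m = int k"
  have "m mod 4 = int (k mod 4)" by (simp add: m_def zmod_int)
  note coeffs = coefficients_mod_8[of m, unfolded this]
  define a' where "a' = (4 * m + 3) * c + 2 * (m + 1) * (4 * m + 1) * a"
  define c' where "c' = a' + 2 * (m + 1) * ((4 * m + 3) * c + (4 * m + 1) * a)"
  have a': "a' mod 8 = ((4 * m + 3) mod 8 * (c mod 8)
      + (2 * (m + 1)) mod 8 * ((4 * m + 1) mod 8) * (a mod 8)) mod 8"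
    unfolding a'_def by (intro mod_add_cong mod_mult_cong)
      (simp_all only: mod_mod_trivial)
  have c': "c' mod 8 = (a' mod 8 + (2 * (m + 1)) mod 8 *
      ((4 * m + 3) mod 8 * (c mod 8) + (4 * m + 1) mod 8 * (a mod 8))) mod 8"
    unfolding c'_def by (intro mod_add_cong mod_mult_cong)
      (simp_all only: mod_mod_trivial)
  \<comment> \<open>Each row of the table reduces to a numerical evaluation; \<open>mod_Suc\<close>
    handles the wrap from 3 to 0.\<close>
  have "(Suc k mod 4, a' mod 8, c' mod 8) \<in> {(0, 1, 1), (1, 5, 5), (2, 7, 7), (3, 7, 7)}"
    using res unfolding a' c' coeffs mod_Suc by auto
  moreover have "weighted_involutions 1 (4 * Suc k) = 2 ^ Suc k * a'"
    "weighted_involutions 1 (4 * Suc k + 1) = 2 ^ Suc k * c'"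
    using weighted_involutions_step4(1,2)[OF ac refl]
    unfolding a'_def c'_def m_def power_Suc by blast+
  ultimately show ?case by (intro exI conjI)
qed

text \<open>The same argument with the map for \<open>w = - 1\<close>: the pair
  \<open>(1, 1)\<close> again returns after four rounds, along a different orbit.\<close>

lemma weighted_involutions_minus_residues:
  "\<exists>b d. weighted_involutions (- 1) (4 * k) = 2 ^ k * b \<and>
    weighted_involutions (- 1) (4 * k + 1) = 2 ^ k * d \<and>
    (k mod 4, b mod 8, d mod 8) \<in> {(0, 1, 1), (1, 7, 3), (2, 7, 7), (3, 5, 1)}"
proof (induction k)
  case 0
  show ?case by (intro exI[of _ 1]) simp
next
  case (Suc k)
  then obtain b d where bd: "weighted_involutions (- 1) (4 * k) = 2 ^ k * b"
    "weighted_involutions (- 1) (4 * k + 1) = 2 ^ k * d"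
    and res: "(k mod 4, b mod 8, d mod 8) \<in> {(0, 1, 1), (1, 7, 3), (2, 7, 7), (3, 5, 1)}"
    by (elim exE conjE) (rule that; assumption)
  define m where "m = int k"
  have "m mod 4 = int (k mod 4)" by (simp add: m_def zmod_int)
  note coeffs = coefficients_mod_8[of m, unfolded this]
  define b' where "b' = (4 * m + 1) * (2 * m + 1) * b - (4 * m + 2) * d"
  define d' where "d' = b' + 2 * (m + 1) * (4 * m + 1) * (d + b)"
  have b': "b' mod 8 = ((4 * m + 1) mod 8 * ((2 * m + 1) mod 8) * (b mod 8)
      - (4 * m + 2) mod 8 * (d mod 8)) mod 8"
    unfolding b'_def by (intro mod_add_cong mod_diff_cong mod_mult_cong)
      (simp_all only: mod_mod_trivial)
  have d': "d' mod 8 = (b' mod 8 + (2 * (m + 1)) mod 8 * ((4 * m + 1) mod 8) *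
      (d mod 8 + b mod 8)) mod 8"
    unfolding d'_def by (intro mod_add_cong mod_diff_cong mod_mult_cong)
      (simp_all only: mod_mod_trivial)
  have "(Suc k mod 4, b' mod 8, d' mod 8) \<in> {(0, 1, 1), (1, 7, 3), (2, 7, 7), (3, 5, 1)}"
    using res unfolding b' d' coeffs mod_Suc by auto
  moreover have "weighted_involutions (- 1) (4 * Suc k) = 2 ^ Suc k * b'"
    "weighted_involutions (- 1) (4 * Suc k + 1) = 2 ^ Suc k * d'"
    using weighted_involutions_step4(3,4)[OF bd refl]
    unfolding b'_def d'_def m_def power_Suc by blast+
  ultimately show ?case by (intro exI conjI)
qed

section \<open>The 2-adic order\<close>

theorem theorem5p4:
  fixes k :: nat
  shows "multiplicity 2 (t_e (4 * k)) = 2 * ((k + 1) div 2)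
    \<and> 2 * ((k + 1) div 2) = k + chi_o k"
proof -
  obtain a c where a: "weighted_involutions 1 (4 * k) = 2 ^ k * a"
    and ra: "(k mod 4, a mod 8, c mod 8) \<in> {(0, 1, 1), (1, 5, 5), (2, 7, 7), (3, 7, 7 :: int)}"
    using weighted_involutions_plus_residues[of k]
    by (elim exE conjE) (rule that; assumption)
  obtain b d where b: "weighted_involutions (- 1) (4 * k) = 2 ^ k * b"
    and rb: "(k mod 4, b mod 8, d mod 8) \<in> {(0, 1, 1), (1, 7, 3), (2, 7, 7), (3, 5, 1 :: int)}"
    using weighted_involutions_minus_residues[of k]
    by (elim exE conjE) (rule that; assumption)
  have e: "2 * int (t_e (4 * k)) = 2 ^ k * (a + b)"
    by (simp add: t_e_weighted a b distrib_left)
  have chi: "2 * ((k + 1) div 2) = k + chi_o k" by (auto simp: chi_o_def elim!: oddE)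
  \<comment> \<open>The explicit factor 2 cancels the one on the left of \<open>e\<close>;
    \<open>2 ^ chi_o k\<close> is the excess over \<open>2 ^ k\<close>.\<close>
  have "\<exists>q. odd q \<and> a + b = 2 * 2 ^ chi_o k * q"
  proof (cases "odd k")
    case True
    then have "k mod 4 = 1 \<or> k mod 4 = 3" by presburger
    then have "(a mod 8 = 5 \<and> b mod 8 = 7) \<or> (a mod 8 = 7 \<and> b mod 8 = 5)"
      using ra rb by (elim disjE) simp_all
    \<comment> \<open>Here \<open>5 + 7 = 12\<close>. Residues modulo 4 would only show that 4
      divides the sum; modulus 8 rules out a further factor 2.\<close>
    then have "(a + b) mod 8 = 4" unfolding mod_add_eq[of a 8 b, symmetric] by auto
    then have "\<exists>q. odd q \<and> a + b = 4 * q" by presburger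
    then show ?thesis using True by (simp add: chi_o_def)
  next
    case False
    then have "k mod 4 = 0 \<or> k mod 4 = 2" by presburger
    then have "(a mod 8 = 1 \<and> b mod 8 = 1) \<or> (a mod 8 = 7 \<and> b mod 8 = 7)"
      using ra rb by (elim disjE) simp_all
    then have "(a + b) mod 8 = 2 \<or> (a + b) mod 8 = 6"
      unfolding mod_add_eq[of a 8 b, symmetric] by auto
    then have "\<exists>q. odd q \<and> a + b = 2 * q" by presburger
    then show ?thesis using False by (simp add: chi_o_def)
  qed
  then obtain q where q: "odd q" "a + b = 2 * 2 ^ chi_o k * q" by blast
  have eq: "int (t_e (4 * k)) = 2 ^ (k + chi_o k) * q"
    using e by (simp add: q(2) power_add)
  have "multiplicity 2 (t_e (4 * k)) = k + chi_o k"
  proof (rule multiplicity_eqI)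
    have "int (2 ^ (k + chi_o k)) dvd int (t_e (4 * k))" by (simp add: eq)
    then show "2 ^ (k + chi_o k) dvd t_e (4 * k)" by (simp only: int_dvd_int_iff)
    have "\<not> int (2 ^ Suc (k + chi_o k)) dvd int (t_e (4 * k))"
      using q(1) by (simp add: eq power_Suc2 del: power_Suc)
    then show "\<not> 2 ^ Suc (k + chi_o k) dvd t_e (4 * k)"
      by (simp only: int_dvd_int_iff not_False_eq_True)
  qed
  then show ?thesis using chi by simp
qed

end
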